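(* Let $(W,R)$ be a Coxeter system with $R$ finite and non-empty, and let $\Gamma$ be its Coxeter graph. For every Coxeter element $w$ of $W$, the involution length $\ell_{\mathrm{inv}}(w)$ equals the path length of $w$. Hence the maximum of $\ell_{\mathrm{inv}}(w)$ over all Coxeter elements $w$ of $W$ equals the maximum path length of $\Gamma$, i.e. the maximum number of vertices in a path in $\Gamma$.
   Context: $(W,R)$ is a Coxeter system with set $R$ of simple reflections, and $\ell$ is the length function with respect to $R$. The Coxeter graph $\Gamma$ has vertex set $R$, with distinct $r,s\in R$ joined by an edge if and only if $rs\neq sr$ (edge labels are irrelevant here). A path in $\Gamma$ is a sequence of distinct vertices $r_1,\ldots,r_m$ ($m\geq 1$) with $r_i$ joined to $r_{i+1}$ by an edge for $1\le i<m$; its length is the number $m$ of its vertices (so a single vertex is a path of length $1$). A Coxeter element of $W$ is a product of all the simple reflections in some order, with each $r\in R$ appearing exactly once. For a Coxeter element $w$, a $w$-path is a path $r_1,\ldots,r_m$ in $\Gamma$ such that there is a reduced expression for $w$ in which $r_i$ appears to the left of $r_{i+1}$ for each $1\le i<m$. The path length of $w$ is the maximum length of any $w$-path. An element $u\in W$ is a prefix of $w$ if $w=uv$ for some $v\in W$ with $\ell(w)=\ell(u)+\ell(v)$. An involution is an element of order exactly $2$. Let $\mathcal{IP}(w)$ be the set of prefixes of $w$ that are involutions, and let $A(w)=\{u\in\mathcal{IP}(w):\ell(u)=\max_{v\in\mathcal{IP}(w)}\ell(v)\}$. If $w\ne 1$ and $|A(w)|=1$, the unique element of $A(w)$ is called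 the ancestor of $w$ and denoted $a(w)$. The ancestor decomposition of $w\neq 1$ is the expression $w=a_1a_2\cdots a_k$ with $a_i=a(a_ia_{i+1}\cdots a_k)$ for each $1\le i\le k$; that is, one repeatedly splits off the ancestor on the left, until nothing remains. The involution length $\ell_{\mathrm{inv}}(w)$ is the number $k$ of terms in this decomposition, with $\ell_{\mathrm{inv}}(1)=0$. For a Coxeter element $w$ of $W$ the ancestor decomposition exists and is unique: every non-identity Coxeter element of a Coxeter group of finite rank has a unique ancestor, equal to the product of the pairwise commuting simple reflections in its left descent set $D(w)=\{r\in R:\ell(rw)<\ell(w)\}$, and $a(w)^{-1}w$ is a Coxeter element of the standard parabolic subgroup generated by $R\setminus D(w)$. Hence $\ell_{\mathrm{inv}}(w)$ is well defined. *)

theory Defs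
  imports "HOL-Algebra.Algebra"
begin

section \<open>Coxeter systems\<close>

definition word_prod :: "('a, 'b) monoid_scheme \<Rightarrow> 'a list \<Rightarrow> 'a" where
  "word_prod G xs = foldr (\<lambda>x y. x \<otimes>\<^bsub>G\<^esub> y) xs \<one>\<^bsub>G\<^esub>"

text \<open>The congruence on words over \<open>R\<close> generated by the relators \<open>(rs)\<^sup>m\<close>, where \<open>m\<close> is the order
  of \<open>rs\<close> in \<open>G\<close>. Since \<open>group.ord\<close> is \<open>0\<close> for elements of infinite order, such a pair only
  contributes the void relator \<open>[]\<close>. When the elements of \<open>R\<close> have order 2, the
  case \<open>r = s\<close> gives the relator \<open>r\<^sup>2\<close>, so letters are their own formal inverses and the classes of
  words form the group presented by \<open>R\<close> and these relators.\<close>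

inductive coxeter_equiv :: "('a, 'b) monoid_scheme \<Rightarrow> 'a set \<Rightarrow> 'a list \<Rightarrow> 'a list \<Rightarrow> bool"
  for G and R where
  relator: "\<lbrakk>u \<in> lists R; v \<in> lists R; r \<in> R; s \<in> R\<rbrakk> \<Longrightarrow>
     coxeter_equiv G R (u @ concat (replicate (group.ord G (r \<otimes>\<^bsub>G\<^esub> s)) [r, s]) @ v) (u @ v)"
| refl: "u \<in> lists R \<Longrightarrow> coxeter_equiv G R u u"
| sym: "coxeter_equiv G R u v \<Longrightarrow> coxeter_equiv G R v u"
| trans: "\<lbrakk>coxeter_equiv G R u v; coxeter_equiv G R v w\<rbrakk> \<Longrightarrow> coxeter_equiv G R u w"

text \<open>\<open>(G, R)\<close> is a Coxeter system in the sense of Bourbaki: \<open>R\<close> consists of elements of order 2,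
  generates \<open>G\<close>, and together with the relations \<open>(rs)\<^sup>m = 1\<close>, for \<open>m\<close> the (finite) order of \<open>rs\<close>,
  presents \<open>G\<close>.\<close>

locale coxeter_system = group G for G (structure) +
  fixes R :: "'a set"
  assumes R_subset: "R \<subseteq> carrier G"
    and R_order_2: "r \<in> R \<Longrightarrow> ord r = 2"
    and R_generates: "generate G R = carrier G"
    and R_presents: "\<lbrakk>u \<in> lists R; v \<in> lists R\<rbrakk> \<Longrightarrow>
      word_prod G u = word_prod G v \<longleftrightarrow> coxeter_equiv G R u v"

definition cox_length :: "('a, 'b) monoid_scheme \<Rightarrow> 'a set \<Rightarrow> 'a \<Rightarrow> nat" where
  "cox_length G R w = (LEAST n. \<exists>xs \<in> lists R. length xs = n \<and> word_prod G xs = w)"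

definition reduced_expression :: "('a, 'b) monoid_scheme \<Rightarrow> 'a set \<Rightarrow> 'a \<Rightarrow> 'a list \<Rightarrow> bool" where
  "reduced_expression G R w xs \<longleftrightarrow>
     xs \<in> lists R \<and> word_prod G xs = w \<and> length xs = cox_length G R w"

definition coxeter_element :: "('a, 'b) monoid_scheme \<Rightarrow> 'a set \<Rightarrow> 'a \<Rightarrow> bool" where
  "coxeter_element G R w \<longleftrightarrow> (\<exists>xs. distinct xs \<and> set xs = R \<and> word_prod G xs = w)"

section \<open>Paths in the Coxeter graph\<close>

definition coxeter_adj :: "('a, 'b) monoid_scheme \<Rightarrow> 'a set \<Rightarrow> 'a \<Rightarrow> 'a \<Rightarrow> bool" where
  "coxeter_adj G R r s \<longleftrightarrow> r \<in> R \<and> s \<in> R \<and> r \<noteq> s \<and> r \<otimes>\<^bsub>G\<^esub> s \<noteq> s \<otimes>\<^bsub>G\<^esub> r"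

text \<open>The length of a path is the number of its vertices, i.e. its length as a list.\<close>

definition coxeter_path :: "('a, 'b) monoid_scheme \<Rightarrow> 'a set \<Rightarrow> 'a list \<Rightarrow> bool" where
  "coxeter_path G R p \<longleftrightarrow>
     p \<noteq> [] \<and> distinct p \<and> set p \<subseteq> R \<and> successively (coxeter_adj G R) p"

definition appears_left_of :: "'a list \<Rightarrow> 'a \<Rightarrow> 'a \<Rightarrow> bool" where
  "appears_left_of xs r s \<longleftrightarrow> (\<exists>i j. i < j \<and> j < length xs \<and> xs ! i = r \<and> xs ! j = s)"

definition w_path :: "('a, 'b) monoid_scheme \<Rightarrow> 'a set \<Rightarrow> 'a \<Rightarrow> 'a list \<Rightarrow> bool" where
  "w_path G R w p \<longleftrightarrow> coxeter_path G R p \<and>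
     (\<exists>xs. reduced_expression G R w xs \<and>
       (\<forall>i. Suc i < length p \<longrightarrow> appears_left_of xs (p ! i) (p ! Suc i)))"

definition path_length :: "('a, 'b) monoid_scheme \<Rightarrow> 'a set \<Rightarrow> 'a \<Rightarrow> nat" where
  "path_length G R w = Max {length p | p. w_path G R w p}"

definition max_path_length :: "('a, 'b) monoid_scheme \<Rightarrow> 'a set \<Rightarrow> nat" where
  "max_path_length G R = Max {length p | p. coxeter_path G R p}"

section \<open>Ancestors and involution length\<close>

definition is_prefix :: "('a, 'b) monoid_scheme \<Rightarrow> 'a set \<Rightarrow> 'a \<Rightarrow> 'a \<Rightarrow> bool" where
  "is_prefix G R u w \<longleftrightarrow> u \<in> carrier G \<and>
     (\<exists>v \<in> carrier G. w = u \<otimes>\<^bsub>G\<^esub> v \<and> cox_length G R w = cox_length G R u + cox_length G R v)"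

definition involution_prefixes :: "('a, 'b) monoid_scheme \<Rightarrow> 'a set \<Rightarrow> 'a \<Rightarrow> 'a set" where
  "involution_prefixes G R w = {u. is_prefix G R u w \<and> group.ord G u = 2}"

text \<open>The lengths below are bounded by the length of \<open>w\<close>, so \<open>Max\<close> ranges over a finite set.\<close>

definition max_involution_prefixes :: "('a, 'b) monoid_scheme \<Rightarrow> 'a set \<Rightarrow> 'a \<Rightarrow> 'a set" where
  "max_involution_prefixes G R w =
     {u \<in> involution_prefixes G R w.
        cox_length G R u = Max (cox_length G R ` involution_prefixes G R w)}"

text \<open>Ancestors need not exist in general, so \<open>a = a(w)\<close> is rendered as a relation.\<close>

definition is_ancestor :: "('a, 'b) monoid_scheme \<Rightarrow> 'a set \<Rightarrow> 'a \<Rightarrow> 'a \<Rightarrow> bool" where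
  "is_ancestor G R w a \<longleftrightarrow> w \<noteq> \<one>\<^bsub>G\<^esub> \<and> max_involution_prefixes G R w = {a}"

text \<open>For \<open>w = 1\<close> the only decomposition is the empty one, as \<open>1\<close> has no ancestor.\<close>

definition ancestor_decomposition :: "('a, 'b) monoid_scheme \<Rightarrow> 'a set \<Rightarrow> 'a \<Rightarrow> 'a list \<Rightarrow> bool" where
  "ancestor_decomposition G R w as \<longleftrightarrow> word_prod G as = w \<and>
     (\<forall>i < length as. is_ancestor G R (word_prod G (drop i as)) (as ! i))"

definition inv_length :: "('a, 'b) monoid_scheme \<Rightarrow> 'a set \<Rightarrow> 'a \<Rightarrow> nat" where
  "inv_length G R w = length (THE as. ancestor_decomposition G R w as)"

end

theory Submission
  imports Defs
begin

text \<open>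
  A Coxeter element is the product of a word in which every simple reflection occurs exactly once.
  Such a word orients the Coxeter graph: each edge points from the letter that comes first to the
  one that comes later. The orientation depends only on the element (lemma
  \<open>word_order_invariant\<close>), and \<open>w\<close>-paths are precisely its directed paths. The sources of the
  orientation are the letters that commute with everything to their left; they commute with each
  other, and their product is the ancestor (lemma \<open>ancestor_iff\<close>). Splitting off the ancestor
  deletes all sources, and this shortens the longest directed path by exactly one vertex, since a
  source can only be the first vertex of a directed path, and a directed path that starts at a
  non-source can be extended to the left. By induction the number of ancestors that are
  split off is the number of vertices of a longest directed path (lemma
  \<open>ancestor_decomposition_longest_chain\<close>). For the second claim, writing the vertices of a given
  path in \<open>\<Gamma>\<close> first, in their order along the path, yields a Coxeter element for which it is a
  directed path.

  What has to be known about Coxeter groups is that a word with distinct letters is determined by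
  its product up to commutations. This comes from the reflections
  \<open>r\<^sub>1 \<dots> r\<^sub>i\<^sub>-\<^sub>1 r\<^sub>i r\<^sub>i\<^sub>-\<^sub>1 \<dots> r\<^sub>1\<close> attached to the positions \<open>i\<close> of a word: the
  parity of the number of times that a given reflection occurs is unchanged by the relators
  (lemma \<open>inverts_cong\<close>). Deleting two letters with equal reflections does not change the
  product; from this and the parity it follows that a simple reflection which is a product of
  letters from a set \<open>J\<close> of simple reflections lies in \<open>J\<close> (lemma \<open>simple_in_parabolic\<close>).
  These two facts give the reducedness of words with distinct letters and the comparison of their
  first letters (lemma \<open>first_letter_commutes_prefix\<close>), on which the rest is built by induction.
\<close>

section \<open>Order of letters in a word\<close>

lemma appears_left_of_Nil [simp]: "\<not> appears_left_of [] r s"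
  by (simp add: appears_left_of_def)

lemma appears_left_of_Cons [simp]:
  "appears_left_of (x # xs) r s \<longleftrightarrow> (x = r \<and> s \<in> set xs) \<or> appears_left_of xs r s"
proof
  assume "appears_left_of (x # xs) r s"
  then obtain i j where ij: "i < j" "j < length (x # xs)" "(x # xs) ! i = r" "(x # xs) ! j = s"
    unfolding appears_left_of_def by blast
  then obtain j' where j: "j = Suc j'" by (cases j) auto
  show "(x = r \<and> s \<in> set xs) \<or> appears_left_of xs r s"
  proof (cases i)
    case 0
    then show ?thesis using ij j by auto
  next
    case (Suc i')
    then show ?thesis using ij j unfolding appears_left_of_def by auto
  qed
next
  assume "(x = r \<and> s \<in> set xs) \<or> appears_left_of xs r s"
  then show "appears_left_of (x # xs) r s"
  proof
    assume "x = r \<and> s \<in> set xs"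
    then obtain j where "j < length xs" "xs ! j = s" "x = r" by (auto simp: in_set_conv_nth)
    then show ?thesis unfolding appears_left_of_def
      by (intro exI[of _ 0] exI[of _ "Suc j"]) auto
  next
    assume "appears_left_of xs r s"
    then obtain i j where "i < j" "j < length xs" "xs ! i = r" "xs ! j = s"
      unfolding appears_left_of_def by blast
    then show ?thesis unfolding appears_left_of_def
      by (intro exI[of _ "Suc i"] exI[of _ "Suc j"]) auto
  qed
qed

lemma appears_left_of_append [simp]:
  "appears_left_of (xs @ ys) r s \<longleftrightarrow>
     appears_left_of xs r s \<or> (r \<in> set xs \<and> s \<in> set ys) \<or> appears_left_of ys r s"
  by (induction xs) auto

lemma appears_left_of_rev [simp]: "appears_left_of (rev xs) r s \<longleftrightarrow> appears_left_of xs s r"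
  by (induction xs) auto

lemma appears_left_of_filter:
  "appears_left_of (filter P xs) r s \<longleftrightarrow> appears_left_of xs r s \<and> P r \<and> P s"
  by (induction xs) auto

lemma appears_left_of_set: "appears_left_of xs r s \<Longrightarrow> r \<in> set xs \<and> s \<in> set xs"
  by (induction xs) auto

lemma appears_left_of_irrefl: "distinct xs \<Longrightarrow> \<not> appears_left_of xs r r"
  by (induction xs) auto

lemma appears_left_of_asym:
  "distinct xs \<Longrightarrow> appears_left_of xs r s \<Longrightarrow> \<not> appears_left_of xs s r"
  by (induction xs) (auto dest: appears_left_of_set)

lemma appears_left_of_trans:
  "distinct xs \<Longrightarrow> appears_left_of xs r s \<Longrightarrow> appears_left_of xs s t \<Longrightarrow> appears_left_of xs r t"
  by (induction xs) (auto dest: appears_left_of_set)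

lemma appears_left_of_total:
  "r \<in> set xs \<Longrightarrow> s \<in> set xs \<Longrightarrow> r \<noteq> s \<Longrightarrow> appears_left_of xs r s \<or> appears_left_of xs s r"
  by (induction xs) auto

context coxeter_system
begin

section \<open>Words and their products\<close>

lemma word_prod_Nil [simp]: "word_prod G [] = \<one>"
  by (simp add: word_prod_def)

lemma word_prod_Cons [simp]: "word_prod G (x # xs) = x \<otimes> word_prod G xs"
  by (simp add: word_prod_def)

lemma R_closed [simp]: "r \<in> R \<Longrightarrow> r \<in> carrier G"
  using R_subset by blast

lemma word_prod_closed [simp]: "set xs \<subseteq> carrier G \<Longrightarrow> word_prod G xs \<in> carrier G"
  by (induction xs) auto

lemma letters_closed [simp]: "set xs \<subseteq> R \<Longrightarrow> set xs \<subseteq> carrier G"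
  using R_subset by blast

lemma word_prod_append:
  "set xs \<subseteq> carrier G \<Longrightarrow> set ys \<subseteq> carrier G \<Longrightarrow>
     word_prod G (xs @ ys) = word_prod G xs \<otimes> word_prod G ys"
  by (induction xs) (auto simp: m_assoc)

lemma R_square [simp]: "r \<in> R \<Longrightarrow> r \<otimes> r = \<one>"
  using R_order_2[of r] pow_ord_eq_1[of r] by (simp add: numeral_2_eq_2)

lemma R_cancel [simp]: "r \<in> R \<Longrightarrow> x \<in> carrier G \<Longrightarrow> r \<otimes> (r \<otimes> x) = x"
  by (simp flip: m_assoc)

lemma R_inv [simp]: "r \<in> R \<Longrightarrow> inv r = r"
  by (simp add: inv_equality)

lemma R_not_one: "r \<in> R \<Longrightarrow> r \<noteq> \<one>"
  using R_order_2[of r] ord_eq_1[of r] by auto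

lemma inv_word_prod:
  "set xs \<subseteq> R \<Longrightarrow> inv (word_prod G xs) = word_prod G (rev xs)"
  by (induction xs) (auto simp: inv_mult_group word_prod_append)

lemma carrier_word:
  assumes "g \<in> carrier G"
  obtains xs where "set xs \<subseteq> R" "word_prod G xs = g"
proof -
  have "g \<in> generate G R" using assms R_generates by simp
  then have "\<exists>xs. set xs \<subseteq> R \<and> word_prod G xs = g"
  proof induction
    case one
    then show ?case by (intro exI[of _ "[]"]) simp
  next
    case (incl h)
    then show ?case by (intro exI[of _ "[h]"]) simp
  next
    case (inv h)
    then show ?case by (intro exI[of _ "[h]"]) simp
  next
    case (eng h1 h2)
    then obtain xs ys where "set xs \<subseteq> R" "word_prod G xs = h1" "set ys \<subseteq> R" "word_prod G ys = h2"
      by blast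
    then show ?case by (intro exI[of _ "xs @ ys"]) (simp add: word_prod_append)
  qed
  then show ?thesis using that by blast
qed

lemma word_prod_commute:
  assumes "x \<in> carrier G" "set ys \<subseteq> carrier G" "\<And>y. y \<in> set ys \<Longrightarrow> x \<otimes> y = y \<otimes> x"
  shows "x \<otimes> word_prod G ys = word_prod G ys \<otimes> x"
  using assms(2,3)
proof (induction ys)
  case Nil
  then show ?case using assms(1) by simp
next
  case (Cons y ys)
  have "x \<otimes> (y \<otimes> word_prod G ys) = y \<otimes> (x \<otimes> word_prod G ys)"
    using Cons.prems assms(1) by (simp flip: m_assoc)
  then show ?case using Cons assms(1) by (simp add: m_assoc)
qed

section \<open>The parity of a reflection in a word\<close>

text \<open>\<open>inverts xs t\<close> says that \<open>t\<close> occurs an odd number of times among the reflections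
  \<open>r\<^sub>1 \<dots> r\<^sub>i\<^sub>-\<^sub>1 r\<^sub>i r\<^sub>i\<^sub>-\<^sub>1 \<dots> r\<^sub>1\<close> of the word \<open>xs = [r\<^sub>1, \<dots>, r\<^sub>n]\<close>: the first letter contributes
  itself, and the reflections of the remaining word are conjugated by it. For elements of \<open>R\<close> the
  conjugation is written without inverses. If \<open>t\<close> is a reflection, this is the condition
  \<open>\<ell>(tw) < \<ell>(w)\<close> for the product \<open>w\<close> of \<open>xs\<close>.\<close>

primrec inverts :: "'a list \<Rightarrow> 'a \<Rightarrow> bool" where
  "inverts [] t \<longleftrightarrow> False"
| "inverts (r # xs) t \<longleftrightarrow> (t = r) \<noteq> inverts xs (r \<otimes> t \<otimes> r)"

lemma inverts_append:
  assumes "set u \<subseteq> R" "t \<in> carrier G"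
  shows "inverts (u @ v) t \<longleftrightarrow>
    inverts u t \<noteq> inverts v (inv (word_prod G u) \<otimes> t \<otimes> word_prod G u)"
  using assms
proof (induction u arbitrary: t)
  case (Cons r u)
  then have "inv (word_prod G (r # u)) \<otimes> t \<otimes> word_prod G (r # u)
      = inv (word_prod G u) \<otimes> (r \<otimes> t \<otimes> r) \<otimes> word_prod G u"
    by (simp add: inv_mult_group m_assoc)
  moreover have "inverts (u @ v) (r \<otimes> t \<otimes> r) \<longleftrightarrow> inverts u (r \<otimes> t \<otimes> r) \<noteq>
      inverts v (inv (word_prod G u) \<otimes> (r \<otimes> t \<otimes> r) \<otimes> word_prod G u)"
    using Cons by simp
  ultimately show ?case by auto
qed simp

lemma word_prod_relator:
  assumes "r \<in> R" "s \<in> R"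
  shows "word_prod G (concat (replicate k [r, s])) = (r \<otimes> s) [^] k"
proof (induction k)
  case (Suc k)
  have "(r \<otimes> s) [^] Suc k = (r \<otimes> s) \<otimes> (r \<otimes> s) [^] k"
    using assms by (intro nat_pow_Suc2) simp
  then show ?case using assms Suc by (simp add: m_assoc)
qed simp

text \<open>With \<open>c = rs\<close>, the reflections of \<open>(rs)\<^sup>k\<close> are \<open>c\<^sup>i r\<close> for \<open>i < 2k\<close>.\<close>

lemma inverts_relator_power:
  assumes "r \<in> R" "s \<in> R" "t \<in> carrier G"
  shows "inverts (concat (replicate k [r, s])) t \<longleftrightarrow>
    odd (\<Sum>i<2 * k. of_bool (t = (r \<otimes> s) [^] i \<otimes> r) :: nat)"
  using assms(3)
proof (induction k arbitrary: t)
  case (Suc k)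
  define c where "c = r \<otimes> s"
  have c: "c \<in> carrier G" using assms by (simp add: c_def)
  have shift: "s \<otimes> (r \<otimes> t \<otimes> r) \<otimes> s = c [^] i \<otimes> r \<longleftrightarrow> t = c [^] Suc (Suc i) \<otimes> r" for i :: nat
  proof -
    have "c [^] Suc (Suc i) \<otimes> r = c \<otimes> (c [^] i \<otimes> c) \<otimes> r"
      using nat_pow_Suc2[OF c, of "Suc i"] by simp
    also have "\<dots> = r \<otimes> (s \<otimes> (c [^] i \<otimes> r) \<otimes> s) \<otimes> r"
      using assms c by (simp add: c_def m_assoc)
    finally have eq: "c [^] Suc (Suc i) \<otimes> r = r \<otimes> (s \<otimes> (c [^] i \<otimes> r) \<otimes> s) \<otimes> r" .
    define x where "x = c [^] i \<otimes> r"
    have x: "x \<in> carrier G" using assms c by (simp add: x_def)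
    have "t = r \<otimes> (s \<otimes> (s \<otimes> (r \<otimes> t \<otimes> r) \<otimes> s) \<otimes> s) \<otimes> r"
      using assms(1,2) Suc.prems by (simp add: m_assoc)
    moreover have "s \<otimes> (r \<otimes> (r \<otimes> (s \<otimes> x \<otimes> s) \<otimes> r) \<otimes> r) \<otimes> s = x"
      using assms(1,2) x by (simp add: m_assoc)
    ultimately show ?thesis unfolding eq x_def[symmetric] by metis
  qed
  have 0: "t = r \<longleftrightarrow> t = c [^] (0::nat) \<otimes> r" using assms by simp
  have 1: "r \<otimes> t \<otimes> r = s \<longleftrightarrow> t = c [^] Suc 0 \<otimes> r"
    using assms Suc.prems by (auto simp: c_def m_assoc)
  have "inverts (concat (replicate (Suc k) [r, s])) t \<longleftrightarrow>
     (t = r) \<noteq> ((r \<otimes> t \<otimes> r = s) \<noteq>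
        odd (\<Sum>i<2 * k. of_bool (s \<otimes> (r \<otimes> t \<otimes> r) \<otimes> s = c [^] i \<otimes> r) :: nat))"
    using Suc assms by (simp add: c_def)
  also have "\<dots> \<longleftrightarrow> odd (\<Sum>i<Suc (Suc (2 * k)). of_bool (t = c [^] i \<otimes> r) :: nat)"
    unfolding shift 0 1 sum.lessThan_Suc_shift by auto
  finally show ?case by (simp add: c_def)
qed simp

text \<open>When \<open>k = m\<close> is the order of \<open>c\<close>, the list of the \<open>c\<^sup>i r\<close> with \<open>i < 2m\<close> runs twice through
  its first half. For infinite order \<open>m = 0\<close> the list is empty.\<close>

lemma inverts_relator:
  assumes "r \<in> R" "s \<in> R" "t \<in> carrier G"
  shows "\<not> inverts (concat (replicate (ord (r \<otimes> s)) [r, s])) t"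
proof -
  define c m where "c = r \<otimes> s" and "m = ord c"
  have c: "c \<in> carrier G" using assms by (simp add: c_def)
  let ?f = "\<lambda>i. of_bool (t = c [^] i \<otimes> r) :: nat"
  have "(\<Sum>i<n + m. ?f i) = (\<Sum>i<m. ?f i) + (\<Sum>i<n. ?f i)" for n
  proof (induction n)
    case (Suc n)
    have "c [^] (n + m) = c [^] n"
      using c pow_ord_eq_1[OF c] by (simp add: m_def nat_pow_mult[symmetric])
    then show ?case using Suc by simp
  qed simp
  from this[of m] have "even (\<Sum>i<2 * m. ?f i)" by (simp add: mult_2)
  then show ?thesis using inverts_relator_power[OF assms, of m] by (simp add: c_def m_def)
qed

lemma inverts_coxeter_equiv:
  assumes "coxeter_equiv G R u v" "t \<in> carrier G"
  shows "inverts u t \<longleftrightarrow> inverts v t"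
  using assms
proof (induction arbitrary: t)
  case (relator u v r s)
  let ?w = "concat (replicate (ord (r \<otimes> s)) [r, s])"
  have sets: "set u \<subseteq> R" "set v \<subseteq> R" "set ?w \<subseteq> R" using relator by auto
  have "word_prod G ?w = \<one>"
    using relator pow_ord_eq_1[of "r \<otimes> s"] by (simp add: word_prod_relator)
  moreover define t' where "t' = inv (word_prod G u) \<otimes> t \<otimes> word_prod G u"
  moreover have "t' \<in> carrier G" using sets relator by (simp add: t'_def)
  ultimately show ?case
    using sets relator inverts_relator[of r s t'] by (simp add: inverts_append)
qed auto

lemma inverts_cong:
  assumes "word_prod G xs = word_prod G ys" "set xs \<subseteq> R" "set ys \<subseteq> R" "t \<in> carrier G"
  shows "inverts xs t \<longleftrightarrow> inverts ys t"
proof -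
  have "xs \<in> lists R" "ys \<in> lists R" using assms by auto
  then have "coxeter_equiv G R xs ys" using R_presents assms(1) by blast
  then show ?thesis using inverts_coxeter_equiv assms(4) by blast
qed

text \<open>A reflection that occurs an odd number of times occurs at least once, so it is the conjugate of a
  letter by the prefix in front of that letter.\<close>

lemma invertsE:
  assumes "inverts xs t" "set xs \<subseteq> R" "t \<in> carrier G"
  obtains u b v where "xs = u @ b # v" "t \<otimes> word_prod G u = word_prod G u \<otimes> b"
proof -
  have "\<exists>u b v. xs = u @ b # v \<and> t \<otimes> word_prod G u = word_prod G u \<otimes> b"
    using assms
  proof (induction xs arbitrary: t)
    case (Cons r xs)
    show ?case
    proof (cases "t = r")
      case True
      then show ?thesis using Cons.prems by (intro exI[of _ "[]"]) simp
    next
      case False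
      then obtain u b v where ubv: "xs = u @ b # v"
        "(r \<otimes> t \<otimes> r) \<otimes> word_prod G u = word_prod G u \<otimes> b"
        using Cons.IH[of "r \<otimes> t \<otimes> r"] Cons.prems by auto
      have cl: "word_prod G u \<in> carrier G" "b \<in> carrier G" "r \<in> R"
        using ubv Cons.prems by auto
      have "t \<otimes> (r \<otimes> word_prod G u) = r \<otimes> ((r \<otimes> t \<otimes> r) \<otimes> word_prod G u)"
        using cl Cons.prems by (simp add: m_assoc)
      then have "t \<otimes> (r \<otimes> word_prod G u) = r \<otimes> word_prod G u \<otimes> b"
        using cl by (simp add: ubv m_assoc)
      then show ?thesis using ubv by (intro exI[of _ "r # u"] exI[of _ b] exI[of _ v]) simp
    qed
  qed simp
  then show ?thesis using that by blast
qed

section \<open>Supports\<close>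

text \<open>Let \<open>a\<close> be the first letter of the word. If the later positions give the reflection \<open>a\<close> an odd
  number of times, then \<open>a\<close> and the letter at one of these positions can be deleted without
  changing the product, and the shorter word is treated by induction. Otherwise \<open>a\<close> occurs an odd
  number of times among the reflections of the whole word, hence among those of the one-letter
  word \<open>[r]\<close>, which has only the reflection \<open>r\<close>.\<close>

lemma simple_in_parabolic:
  assumes "set xs \<subseteq> R" "r \<in> R" "word_prod G xs = r"
  shows "r \<in> set xs"
  using assms
proof (induction xs rule: length_induct)
  case (1 xs)
  note prems = 1(2-4)
  obtain a xs' where xs: "xs = a # xs'"
    using prems R_not_one[of r] by (cases xs) auto
  have a: "a \<in> R" using xs prems by simp
  show ?case
  proof (cases "inverts xs' a")
    case True
    then obtain u b v where ubv: "xs' = u @ b # v" "a \<otimes> word_prod G u = word_prod G u \<otimes> b"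
      using invertsE[of xs' a] prems xs a by auto
    have sets: "set u \<subseteq> R" "b \<in> R" "set v \<subseteq> R" using ubv xs prems by auto
    have "r = (a \<otimes> word_prod G u) \<otimes> (b \<otimes> word_prod G v)"
      using prems sets a unfolding xs ubv(1) by (auto simp: word_prod_append m_assoc)
    also have "\<dots> = word_prod G (u @ v)"
      unfolding ubv(2) using sets by (simp add: word_prod_append m_assoc)
    finally have "word_prod G (u @ v) = r" ..
    moreover have "length (u @ v) < length xs" "set (u @ v) \<subseteq> R" using sets by (auto simp: xs ubv(1))
    ultimately have "r \<in> set (u @ v)"
      using 1(1) prems(2) by blast
    then show ?thesis by (auto simp: xs ubv(1))
  next
    case False
    then have "inverts xs a" using a by (simp add: xs)
    moreover have "word_prod G xs = word_prod G [r]" using prems by simp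
    ultimately have "inverts [r] a"
      using inverts_cong[of xs "[r]" a] prems(1,2) a by (metis R_closed empty_set insert_subset list.simps(15) empty_subsetI)
    then show ?thesis by (simp add: xs)
  qed
qed

text \<open>A word for the same element without some letter \<open>r\<close> of \<open>ys = u @ r # v\<close> would
  express \<open>r\<close> by letters other than \<open>r\<close>.\<close>

lemma support_subset:
  assumes "distinct ys" "set ys \<subseteq> R" "set xs \<subseteq> R" "word_prod G xs = word_prod G ys"
  shows "set ys \<subseteq> set xs"
proof
  fix r assume "r \<in> set ys"
  then obtain u v where ys: "ys = u @ r # v" by (meson split_list)
  have sets: "set u \<subseteq> R" "set v \<subseteq> R" "r \<in> R" using ys assms by auto
  \<comment> \<open>Solving \<open>u r v = xs\<close> for \<open>r\<close>.\<close>
  have "word_prod G (rev u @ xs @ rev v)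
      = inv (word_prod G u) \<otimes> (word_prod G u \<otimes> (r \<otimes> word_prod G v)) \<otimes> inv (word_prod G v)"
    using sets assms(3,4) by (simp add: word_prod_append inv_word_prod ys m_assoc)
  also have "\<dots> = r"
    using sets by (simp add: m_assoc inv_solve_left' r_inv)
  finally have "r \<in> set (rev u @ xs @ rev v)"
    using simple_in_parabolic[of "rev u @ xs @ rev v" r] sets assms(3) by simp
  then show "r \<in> set xs" using assms(1) ys by auto
qed

lemma cox_length_le:
  assumes "set xs \<subseteq> R"
  shows "cox_length G R (word_prod G xs) \<le> length xs"
proof -
  have "xs \<in> lists R" using assms by auto
  then have "\<exists>ys\<in>lists R. length ys = length xs \<and> word_prod G ys = word_prod G xs" by blast
  then show ?thesis unfolding cox_length_def by (rule Least_le)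
qed

lemma reduced_expression_exists:
  assumes "g \<in> carrier G"
  obtains xs where "reduced_expression G R g xs"
proof -
  obtain ys where "set ys \<subseteq> R" "word_prod G ys = g" using carrier_word assms by blast
  then have "\<exists>n. \<exists>xs\<in>lists R. length xs = n \<and> word_prod G xs = g"
    by (intro exI[of _ "length ys"] bexI[of _ ys]) auto
  from LeastI_ex[OF this] show ?thesis
    using that unfolding reduced_expression_def cox_length_def by blast
qed

lemma cox_length_distinct:
  assumes "distinct ys" "set ys \<subseteq> R"
  shows "cox_length G R (word_prod G ys) = length ys"
proof (rule antisym)
  obtain xs where xs: "reduced_expression G R (word_prod G ys) xs"
    using reduced_expression_exists[of "word_prod G ys"] assms by auto
  then have "set ys \<subseteq> set xs"
    using support_subset[of ys xs] assms by (auto simp: reduced_expression_def)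
  then have "card (set ys) \<le> length xs"
    by (meson List.finite_set card_length card_mono order_trans)
  then show "length ys \<le> cox_length G R (word_prod G ys)"
    using xs assms(1) by (simp add: reduced_expression_def distinct_card)
qed (use assms cox_length_le in simp)

lemma reduced_expression_distinct:
  assumes "distinct ys" "set ys \<subseteq> R"
  shows "reduced_expression G R (word_prod G ys) xs \<longleftrightarrow>
    distinct xs \<and> set xs = set ys \<and> word_prod G xs = word_prod G ys"
proof
  assume xs: "reduced_expression G R (word_prod G ys) xs"
  then have "length xs = length ys" "set ys \<subseteq> set xs" "word_prod G xs = word_prod G ys"
    using support_subset[of ys xs] assms cox_length_distinct[OF assms]
    by (auto simp: reduced_expression_def)
  moreover from this have "set ys = set xs"
    using assms(1) by (metis List.finite_set card_length card_seteq distinct_card)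
  ultimately show "distinct xs \<and> set xs = set ys \<and> word_prod G xs = word_prod G ys"
    using assms(1) by (metis card_distinct distinct_card)
next
  assume xs: "distinct xs \<and> set xs = set ys \<and> word_prod G xs = word_prod G ys"
  then have "length xs = length ys" using assms(1) by (metis distinct_card)
  then show "reduced_expression G R (word_prod G ys) xs"
    using xs assms cox_length_distinct[OF assms] by (auto simp: reduced_expression_def)
qed

section \<open>The order of non-commuting letters\<close>

text \<open>If a letter is carried to another one by conjugation with a word, solving for either of the two
  letters gives a word for it, in which it must occur.\<close>

lemma conjugate_letter_support:
  assumes "r \<in> R" "b \<in> R" "set u \<subseteq> R" "r \<otimes> word_prod G u = word_prod G u \<otimes> b"
  shows "r \<in> insert b (set u)" "b \<in> insert r (set u)"
proof -
  have "word_prod G (u @ b # rev u) = (r \<otimes> word_prod G u) \<otimes> inv (word_prod G u)"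
    unfolding assms(4) using assms(2,3) by (simp add: word_prod_append inv_word_prod m_assoc)
  also have "\<dots> = r" using assms(1,3) by (simp add: m_assoc)
  finally show "r \<in> insert b (set u)"
    using simple_in_parabolic[of "u @ b # rev u" r] assms by simp
  have "word_prod G (rev u @ r # u) = inv (word_prod G u) \<otimes> (r \<otimes> word_prod G u)"
    using assms(1,3) by (simp add: word_prod_append inv_word_prod m_assoc)
  also have "\<dots> = b" unfolding assms(4) using assms(2,3) by (simp flip: m_assoc)
  finally show "b \<in> insert r (set u)"
    using simple_in_parabolic[of "rev u @ r # u" b] assms by simp
qed

text \<open>The letter \<open>r\<close> is a reflection of the first word, and no later letter of that word contributes it
  again because \<open>r\<close> is not in their support. Hence \<open>r\<close> is also a reflection of the second word, where
  the support condition forces it to come from the letter \<open>r\<close> itself.\<close>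

lemma first_letter_commutes_prefix:
  assumes "distinct (r # xs)" "set (r # xs) \<subseteq> R" "distinct ys" "set ys \<subseteq> R"
    and eq: "word_prod G (r # xs) = word_prod G ys"
  obtains u v where "ys = u @ r # v" "r \<otimes> word_prod G u = word_prod G u \<otimes> r"
proof -
  have r: "r \<in> R" using assms by simp
  have "\<not> inverts xs r"
  proof
    assume "inverts xs r"
    then obtain u b v where ubv: "xs = u @ b # v" "r \<otimes> word_prod G u = word_prod G u \<otimes> b"
      using invertsE[of xs r] assms r by auto
    then have "r \<in> insert b (set u)"
      using assms by (intro conjugate_letter_support(1)) auto
    then show False using assms(1) ubv by auto
  qed
  then have "inverts ys r"
    using inverts_cong[OF eq, of r] assms r by simp
  then obtain u b v where ubv: "ys = u @ b # v" "r \<otimes> word_prod G u = word_prod G u \<otimes> b"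
    using invertsE[of ys r] assms r by auto
  then have "b \<in> R" "set u \<subseteq> R" "b \<notin> set u" using assms(3,4) by auto
  then have "b = r"
    using conjugate_letter_support(2)[OF r _ _ ubv(2)] by auto
  then show ?thesis using that ubv by simp
qed

text \<open>If \<open>r\<close> commutes with \<open>b \<cdot> u\<close>, then \<open>b \<cdot> u \<cdot> r\<close> and \<open>r \<cdot> b \<cdot> u\<close> are words with distinct letters
  and the same product; the first letter \<open>b\<close> of the left one commutes with what precedes it in the
  right one, which is \<open>r\<close>. Cancelling \<open>b\<close> leaves a shorter word that commutes with \<open>r\<close>.\<close>

lemma commutes_with_word_imp_letters:
  assumes "distinct (r # u)" "set (r # u) \<subseteq> R" "r \<otimes> word_prod G u = word_prod G u \<otimes> r"
    and "a \<in> set u"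
  shows "r \<otimes> a = a \<otimes> r"
  using assms
proof (induction u)
  case (Cons b u)
  have sets: "r \<in> R" "b \<in> R" "set u \<subseteq> R" using Cons.prems by auto
  have "word_prod G (b # u @ [r]) = word_prod G (r # b # u)"
    using Cons.prems(3) sets by (simp add: word_prod_append m_assoc)
  then obtain u' v' where uv: "r # b # u = u' @ b # v'" "b \<otimes> word_prod G u' = word_prod G u' \<otimes> b"
    using first_letter_commutes_prefix[of b "u @ [r]" "r # b # u"] Cons.prems by auto
  have "u' = [r]"
    using uv(1) Cons.prems(1) by (cases u'; cases "tl u'") (auto simp: Cons_eq_append_conv)
  then have comm: "r \<otimes> b = b \<otimes> r" using uv(2) sets by simp
  have "b \<otimes> (r \<otimes> word_prod G u) = b \<otimes> (word_prod G u \<otimes> r)"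
    using Cons.prems(3) sets comm by (metis R_closed m_assoc word_prod_Cons letters_closed word_prod_closed)
  then have "r \<otimes> word_prod G u = word_prod G u \<otimes> r"
    using sets by simp
  then show ?case using Cons comm by auto
qed simp

text \<open>The first letter of one word can be brought to the front of the other, because it commutes with all
  letters before it there. So the only pairs whose order it can change are commuting ones, and it
  can then be cancelled from both words.\<close>

lemma word_order_invariant:
  assumes "distinct xs" "set xs \<subseteq> R" "distinct ys" "set ys \<subseteq> R"
    and "word_prod G xs = word_prod G ys"
    and "appears_left_of xs r s" "coxeter_adj G R r s"
  shows "appears_left_of ys r s"
  using assms
proof (induction xs arbitrary: ys)
  case (Cons x xs)
  note prems = Cons.prems
  obtain u v where ys: "ys = u @ x # v" and comm: "x \<otimes> word_prod G u = word_prod G u \<otimes> x"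
    using first_letter_commutes_prefix[OF prems(1-5)] by blast
  have sets: "set u \<subseteq> R" "set v \<subseteq> R" "x \<in> R" "set xs \<subseteq> R" using ys prems by auto
  have letters: "x \<otimes> a = a \<otimes> x" if "a \<in> set u" for a
    using commutes_with_word_imp_letters[OF _ _ comm that] ys prems by auto
  have "x \<otimes> word_prod G xs = x \<otimes> word_prod G (u @ v)"
    using prems(5) comm sets unfolding ys
    by (simp add: word_prod_append flip: m_assoc)
  then have eq: "word_prod G xs = word_prod G (u @ v)" using sets by simp
  show ?case
  proof (cases "appears_left_of xs r s")
    case True
    then have "appears_left_of (u @ v) r s"
      using Cons.IH[of "u @ v"] prems ys eq by auto
    then show ?thesis using ys by auto
  next
    case False
    then have "x = r" "s \<in> set xs" using prems(6) by auto
    moreover have "set (x # xs) \<subseteq> set ys"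
      using support_subset[of "x # xs" ys] prems by auto
    ultimately have "s \<in> set ys" "s \<noteq> x" using prems(1) by auto
    moreover have "s \<notin> set u" using letters[of s] prems(7) \<open>x = r\<close> by (auto simp: coxeter_adj_def)
    ultimately show ?thesis using ys \<open>x = r\<close> by auto
  qed
qed simp

section \<open>The ancestor of a product of distinct simple reflections\<close>

lemma coxeter_adj_sym: "coxeter_adj G R r s \<Longrightarrow> coxeter_adj G R s r"
  by (auto simp: coxeter_adj_def)

lemma not_adjacent_commute: "r \<in> R \<Longrightarrow> s \<in> R \<Longrightarrow> \<not> coxeter_adj G R r s \<Longrightarrow> r \<otimes> s = s \<otimes> r"
  by (auto simp: coxeter_adj_def)

lemma coxeter_adj_irrefl [simp]: "\<not> coxeter_adj G R r r"
  by (simp add: coxeter_adj_def)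

text \<open>The sources of the orientation of the Coxeter graph by \<open>ys\<close>. If \<open>ys\<close> has distinct letters in
  \<open>R\<close>, those in \<open>ys\<close> form the left descent set of its product.\<close>

definition is_source :: "'a list \<Rightarrow> 'a \<Rightarrow> bool" where
  "is_source ys r \<longleftrightarrow> (\<forall>a. appears_left_of ys a r \<longrightarrow> \<not> coxeter_adj G R a r)"

lemma is_source_hd: "distinct ys \<Longrightarrow> ys \<noteq> [] \<Longrightarrow> is_source ys (hd ys)"
  by (cases ys) (auto simp: is_source_def dest: appears_left_of_set)

lemma ord_eq_2_iff:
  assumes "x \<in> carrier G"
  shows "ord x = 2 \<longleftrightarrow> x \<noteq> \<one> \<and> x \<otimes> x = \<one>"
proof -
  have "ord x dvd 2 \<longleftrightarrow> x \<otimes> x = \<one>"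
    using pow_eq_id[OF assms, of 2] assms by (simp add: numeral_2_eq_2)
  moreover have "ord x dvd 2 \<longleftrightarrow> ord x = 1 \<or> ord x = 2"
    by (metis dvd_refl one_dvd prime_nat_iff two_is_prime_nat)
  ultimately show ?thesis using ord_eq_1[OF assms] assms by auto
qed

text \<open>Reversing a word inverts its product. An involution is thus the product of both the word and its
  reverse, and a non-commuting pair would stand in opposite orders in these two.\<close>

lemma word_prod_involution_iff:
  assumes "distinct xs" "set xs \<subseteq> R"
  shows "ord (word_prod G xs) = 2 \<longleftrightarrow>
    xs \<noteq> [] \<and> (\<forall>r\<in>set xs. \<forall>s\<in>set xs. \<not> coxeter_adj G R r s)"
proof
  assume ord: "ord (word_prod G xs) = 2"
  have sq: "word_prod G xs \<otimes> word_prod G xs = \<one>" and ne: "xs \<noteq> []"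
    using ord assms by (auto simp: ord_eq_2_iff)
  have "inv (word_prod G xs) = word_prod G xs"
    using sq assms by (simp add: inv_equality)
  then have rev: "word_prod G xs = word_prod G (rev xs)" using inv_word_prod assms by simp
  have left: "\<not> coxeter_adj G R r s" if "appears_left_of xs r s" for r s
    using word_order_invariant[of xs "rev xs" r s] rev assms that
      appears_left_of_asym[OF assms(1) that] by auto
  have "\<not> coxeter_adj G R r s" if "r \<in> set xs" "s \<in> set xs" for r s
  proof
    assume adj: "coxeter_adj G R r s"
    then have "r \<noteq> s" by auto
    then show False
      using appears_left_of_total[OF that] left[of r s] left[of s r] adj coxeter_adj_sym[OF adj] by blast
  qed
  then show "xs \<noteq> [] \<and> (\<forall>r\<in>set xs. \<forall>s\<in>set xs. \<not> coxeter_adj G R r s)"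
    using ne by simp
next
  assume comm: "xs \<noteq> [] \<and> (\<forall>r\<in>set xs. \<forall>s\<in>set xs. \<not> coxeter_adj G R r s)"
  have "word_prod G ys \<otimes> word_prod G ys = \<one>" if "set ys \<subseteq> set xs" for ys
    using that
  proof (induction ys)
    case (Cons y ys)
    have sets: "y \<in> R" "set ys \<subseteq> R" using Cons.prems assms by auto
    have "y \<otimes> z = z \<otimes> y" if "z \<in> set ys" for z
      using comm Cons.prems sets that by (intro not_adjacent_commute) auto
    then have "y \<otimes> word_prod G ys = word_prod G ys \<otimes> y"
      using sets by (intro word_prod_commute) auto
    then have "(y \<otimes> word_prod G ys) \<otimes> (y \<otimes> word_prod G ys)
        = word_prod G ys \<otimes> (y \<otimes> (y \<otimes> word_prod G ys))"
      using sets by (simp add: m_assoc)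
    then show ?case using Cons sets by simp
  qed simp
  then have "word_prod G xs \<otimes> word_prod G xs = \<one>" by simp
  moreover have "word_prod G xs \<noteq> \<one>"
    using support_subset[of xs "[]"] assms comm by auto
  ultimately show "ord (word_prod G xs) = 2" using assms by (simp add: ord_eq_2_iff)
qed

text \<open>Each letter satisfying \<open>P\<close> is moved to the left past letters that it commutes with.\<close>

lemma word_prod_filter:
  assumes "set ys \<subseteq> carrier G"
    and "\<And>a r. appears_left_of ys a r \<Longrightarrow> P r \<Longrightarrow> \<not> P a \<Longrightarrow> a \<otimes> r = r \<otimes> a"
  shows "word_prod G ys
    = word_prod G (filter P ys) \<otimes> word_prod G (filter (\<lambda>r. \<not> P r) ys)"
  using assms
proof (induction ys)
  case (Cons y ys)
  let ?p = "word_prod G (filter P ys)" and ?q = "word_prod G (filter (\<lambda>r. \<not> P r) ys)"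
  have cl: "y \<in> carrier G" "?p \<in> carrier G" "?q \<in> carrier G"
    using Cons.prems(1) by (auto intro!: word_prod_closed)
  have IH: "word_prod G ys = ?p \<otimes> ?q" using Cons by auto
  show ?case
  proof (cases "P y")
    case True
    then show ?thesis using IH cl by (simp add: m_assoc)
  next
    case False
    have "y \<otimes> ?p = ?p \<otimes> y"
      using Cons.prems False by (intro word_prod_commute) auto
    then show ?thesis using IH cl False by (simp flip: m_assoc)
  qed
qed simp

lemma word_prod_sources:
  assumes "set ys \<subseteq> R"
  shows "word_prod G ys = word_prod G (filter (is_source ys) ys)
    \<otimes> word_prod G (filter (\<lambda>r. \<not> is_source ys r) ys)"
proof (rule word_prod_filter)
  fix a r assume a: "appears_left_of ys a r" and r: "is_source ys r"
  then have "a \<in> R" "r \<in> R" "\<not> coxeter_adj G R a r"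
    using assms appears_left_of_set[OF a] by (auto simp: is_source_def)
  then show "a \<otimes> r = r \<otimes> a" by (auto simp: coxeter_adj_def)
qed (use assms in simp)

lemma sources_not_adjacent:
  assumes "is_source ys r" "is_source ys s" "r \<in> set ys" "s \<in> set ys"
  shows "\<not> coxeter_adj G R r s"
proof
  assume adj: "coxeter_adj G R r s"
  then have "r \<noteq> s" by auto
  then show False
    using appears_left_of_total[OF assms(3,4)] assms(1,2) adj coxeter_adj_sym[OF adj]
    unfolding is_source_def by blast
qed

lemma word_prod_commuting_cong:
  assumes "distinct xs" "distinct ys" "set xs = set ys" "set xs \<subseteq> R"
    and "\<And>r s. r \<in> set xs \<Longrightarrow> s \<in> set xs \<Longrightarrow> \<not> coxeter_adj G R r s"
  shows "word_prod G xs = word_prod G ys"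
  using assms
proof (induction xs arbitrary: ys)
  case (Cons x xs)
  then obtain u v where ys: "ys = u @ x # v" by (metis list.set_intros(1) split_list)
  have sets: "x \<in> R" "set u \<subseteq> R" "set v \<subseteq> R" using ys Cons.prems by auto
  have "set xs = set (u @ v)" using Cons.prems(1-3) ys by auto
  then have IH: "word_prod G xs = word_prod G (u @ v)"
    using Cons.IH[of "u @ v"] Cons.prems ys by auto
  have "x \<otimes> a = a \<otimes> x" if "a \<in> set u" for a
  proof -
    have "a \<in> set (x # xs)" "a \<in> R" using that Cons.prems(3) ys sets by auto
    then show ?thesis using Cons.prems(5)[of x a] sets by (auto simp: coxeter_adj_def)
  qed
  then have "x \<otimes> word_prod G u = word_prod G u \<otimes> x"
    using sets by (intro word_prod_commute) auto
  then have "x \<otimes> (word_prod G u \<otimes> word_prod G v) = word_prod G u \<otimes> (x \<otimes> word_prod G v)"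
    using sets by (simp flip: m_assoc)
  then show ?case using IH sets by (simp add: ys word_prod_append)
qed simp

text \<open>Let an involution prefix be written with a reduced word \<open>xs\<close>, and complete \<open>xs\<close> to a reduced word for
  the whole element. A letter of \<open>xs\<close> has only letters of \<open>xs\<close> to its left, and it commutes with
  these. Conversely, any set of sources can be moved to the front.\<close>

lemma involution_prefix_iff:
  assumes "distinct ys" "set ys \<subseteq> R"
  shows "u \<in> involution_prefixes G R (word_prod G ys) \<longleftrightarrow>
    (\<exists>xs. u = word_prod G xs \<and> distinct xs \<and> xs \<noteq> [] \<and> set xs \<subseteq> {r \<in> set ys. is_source ys r})"
proof
  assume "u \<in> involution_prefixes G R (word_prod G ys)"
  then obtain v where u: "u \<in> carrier G" "v \<in> carrier G" "ord u = 2"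
      "word_prod G ys = u \<otimes> v"
      "cox_length G R (word_prod G ys) = cox_length G R u + cox_length G R v"
    by (auto simp: involution_prefixes_def is_prefix_def)
  obtain xs zs where xs: "reduced_expression G R u xs" and zs: "reduced_expression G R v zs"
    using reduced_expression_exists u(1,2) by metis
  have "reduced_expression G R (word_prod G ys) (xs @ zs)"
    using xs zs u by (auto simp: reduced_expression_def word_prod_append in_lists_conv_set subset_iff)
  then have xz: "distinct (xs @ zs)" "set (xs @ zs) = set ys"
      "word_prod G (xs @ zs) = word_prod G ys"
    using reduced_expression_distinct[OF assms] by auto
  have ux: "u = word_prod G xs" using xs by (simp add: reduced_expression_def)
  have xR: "set xs \<subseteq> R" using xz assms by auto
  have inv: "xs \<noteq> []" "\<And>r s. r \<in> set xs \<Longrightarrow> s \<in> set xs \<Longrightarrow> \<not> coxeter_adj G R r s"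
    using word_prod_involution_iff[of xs] xz xR u(3) ux by auto
  have "is_source ys r" if r: "r \<in> set xs" for r
    unfolding is_source_def
  proof (intro allI impI notI)
    fix a assume a: "appears_left_of ys a r" "coxeter_adj G R a r"
    have "appears_left_of (xs @ zs) a r"
      using word_order_invariant[of ys "xs @ zs" a r] xz assms a by auto
    then have "a \<in> set xs"
      using r xz(1) by (auto dest: appears_left_of_set)
    then show False using inv r a by auto
  qed
  then show "\<exists>xs. u = word_prod G xs \<and> distinct xs \<and> xs \<noteq> [] \<and> set xs \<subseteq> {r \<in> set ys. is_source ys r}"
    using ux xz inv by (intro exI[of _ xs]) auto
next
  assume "\<exists>xs. u = word_prod G xs \<and> distinct xs \<and> xs \<noteq> [] \<and> set xs \<subseteq> {r \<in> set ys. is_source ys r}"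
  then obtain xs where xs: "u = word_prod G xs" "distinct xs" "xs \<noteq> []"
      "set xs \<subseteq> {r \<in> set ys. is_source ys r}" by blast
  have xR: "set xs \<subseteq> R" using xs assms by auto
  let ?zs = "filter (\<lambda>r. r \<notin> set xs) ys" and ?xs = "filter (\<lambda>r. r \<in> set xs) ys"
  have comm: "a \<otimes> r = r \<otimes> a" if "appears_left_of ys a r" "r \<in> set xs" for a r
  proof -
    have "a \<in> R" "r \<in> R" "\<not> coxeter_adj G R a r"
      using xs that assms appears_left_of_set[OF that(1)] by (auto simp: is_source_def)
    then show ?thesis by (auto simp: coxeter_adj_def)
  qed
  have sub: "set ?xs \<subseteq> R" "set ?zs \<subseteq> R" "set ?xs = set xs" using assms xs by auto
  have na: "\<not> coxeter_adj G R r s" if "r \<in> set xs" "s \<in> set xs" for r s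
    using that xs(4) sources_not_adjacent[of ys r s] by auto
  have ord: "ord u = 2"
    using word_prod_involution_iff[of xs] xs xR na by blast
  have u: "u = word_prod G ?xs"
    using xs xR na assms by (auto intro!: word_prod_commuting_cong)
  have "word_prod G ys = u \<otimes> word_prod G ?zs"
    unfolding u using assms comm by (intro word_prod_filter) auto
  moreover have "cox_length G R (word_prod G ys) = cox_length G R u + cox_length G R (word_prod G ?zs)"
    unfolding u using assms sub sum_length_filter_compl[of "\<lambda>r. r \<in> set xs" ys]
    by (simp add: cox_length_distinct)
  moreover have "u \<in> carrier G" "word_prod G ?zs \<in> carrier G"
    using xs(1) letters_closed[OF xR] letters_closed[OF sub(2)] by simp_all
  ultimately show "u \<in> involution_prefixes G R (word_prod G ys)"
    unfolding involution_prefixes_def is_prefix_def using ord by blast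
qed

text \<open>The product of a set of sources has the size of the set as its length, so the longest involution
  prefix takes all sources.\<close>

lemma ancestor_iff:
  assumes "distinct ys" "set ys \<subseteq> R" "ys \<noteq> []"
  shows "is_ancestor G R (word_prod G ys) a \<longleftrightarrow> a = word_prod G (filter (is_source ys) ys)"
proof -
  let ?S = "filter (is_source ys) ys" and ?w = "word_prod G ys"
  have S: "set ?S = {r \<in> set ys. is_source ys r}" "distinct ?S" "set ?S \<subseteq> R"
    using assms by auto
  have lenS: "cox_length G R (word_prod G ?S) = length ?S"
    using S cox_length_distinct by blast
  have "is_source ys (hd ys)"
    using assms(1,3) is_source_hd by blast
  then have "?S \<noteq> []" using assms(3) by (auto simp: filter_empty_conv)
  then have mem: "word_prod G ?S \<in> involution_prefixes G R ?w"
    using involution_prefix_iff[OF assms(1,2)] S by blast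
  have le: "cox_length G R u \<le> length ?S \<and> (cox_length G R u = length ?S \<longrightarrow> u = word_prod G ?S)"
    if u: "u \<in> involution_prefixes G R ?w" for u
  proof -
    obtain xs where xs: "u = word_prod G xs" "distinct xs" "set xs \<subseteq> set ?S"
      using u unfolding S(1) involution_prefix_iff[OF assms(1,2)] by blast
    have xR: "set xs \<subseteq> R" using xs(3) S(3) by blast
    have len: "cox_length G R u = length xs"
      using xs xR cox_length_distinct by blast
    have "length xs = card (set xs)" "length ?S = card (set ?S)"
      using xs(2) S(2) by (simp_all only: distinct_card)
    moreover have "card (set xs) \<le> card (set ?S)" by (rule card_mono) (use xs in auto)
    moreover have "u = word_prod G ?S" if "card (set xs) = card (set ?S)"
    proof -
      have "set xs = set ?S" using that xs(3) by (intro card_subset_eq) auto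
      then show ?thesis unfolding xs(1)
        using xs(2) S(2) xR sources_not_adjacent[of ys]
        by (intro word_prod_commuting_cong) auto
    qed
    ultimately show ?thesis unfolding len by presburger
  qed
  have Max: "Max (cox_length G R ` involution_prefixes G R ?w) = length ?S"
  proof (rule Max_eqI)
    show "finite (cox_length G R ` involution_prefixes G R ?w)"
    proof (rule finite_subset)
      show "cox_length G R ` involution_prefixes G R ?w \<subseteq> {..length ?S}" using le by blast
    qed simp
    show "n \<le> length ?S" if "n \<in> cox_length G R ` involution_prefixes G R ?w" for n
      using that le by blast
    show "length ?S \<in> cox_length G R ` involution_prefixes G R ?w"
      using mem lenS by (metis imageI)
  qed
  have "u \<in> max_involution_prefixes G R ?w \<longleftrightarrow> u = word_prod G ?S" for u
    unfolding max_involution_prefixes_def Max mem_Collect_eq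
  proof
    assume "u \<in> involution_prefixes G R ?w \<and> cox_length G R u = length ?S"
    then show "u = word_prod G ?S" using le by blast
  qed (use mem lenS in simp)
  then have "max_involution_prefixes G R ?w = {word_prod G ?S}" by blast
  moreover have "?w \<noteq> \<one>"
    using support_subset[of ys "[]"] assms by auto
  ultimately show ?thesis by (auto simp: is_ancestor_def)
qed

section \<open>Chains and the ancestor decomposition\<close>

text \<open>The directed paths of the orientation by \<open>ys\<close>. The empty path is included, so that the longest
  chain of the empty word has as many vertices as the ancestor decomposition of \<open>\<one>\<close> has
  terms. The word need not contain all of \<open>R\<close>, because letters are removed in the
  induction.\<close>

definition letter_chain :: "'a list \<Rightarrow> 'a list \<Rightarrow> bool" where
  "letter_chain ys p \<longleftrightarrow> set p \<subseteq> set ys \<and>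
     successively (\<lambda>r s. appears_left_of ys r s \<and> coxeter_adj G R r s) p"

lemma letter_chain_Nil [simp]: "letter_chain ys []"
  by (simp add: letter_chain_def)

lemma letter_chain_Cons:
  "letter_chain ys (r # p) \<longleftrightarrow> r \<in> set ys \<and> letter_chain ys p \<and>
     (p \<noteq> [] \<longrightarrow> appears_left_of ys r (hd p) \<and> coxeter_adj G R r (hd p))"
  by (cases p) (auto simp: letter_chain_def)

lemma letter_chain_distinct:
  assumes "distinct ys" "letter_chain ys p"
  shows "distinct p"
proof -
  have "successively (appears_left_of ys) p"
    using assms(2) unfolding letter_chain_def by (auto intro: successively_mono)
  moreover have "transp (appears_left_of ys)"
    using appears_left_of_trans[OF assms(1)] by (auto intro: transpI)
  ultimately have "sorted_wrt (appears_left_of ys) p"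
    by (simp add: successively_conv_sorted_wrt)
  then show ?thesis
    using appears_left_of_irrefl[OF assms(1)] by (induction p) auto
qed

lemma letter_chain_filter_nonsources:
  "letter_chain (filter (\<lambda>r. \<not> is_source ys r) ys) p \<longleftrightarrow>
     letter_chain ys p \<and> (\<forall>r\<in>set p. \<not> is_source ys r)"
  by (induction p) (auto simp: letter_chain_Cons appears_left_of_filter)

text \<open>Any vertex after the first has its predecessor as a non-commuting letter to its left.\<close>

lemma letter_chain_tl_nonsource:
  "letter_chain ys (r # p) \<Longrightarrow> s \<in> set p \<Longrightarrow> \<not> is_source ys s"
  by (induction p arbitrary: r) (auto simp: letter_chain_Cons is_source_def)

lemma ancestor_decomposition_Nil:
  "ancestor_decomposition G R \<one> as \<longleftrightarrow> as = []"
proof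
  assume as: "ancestor_decomposition G R \<one> as"
  show "as = []"
  proof (rule ccontr)
    assume "as \<noteq> []"
    then have "is_ancestor G R (word_prod G as) (as ! 0)"
      using as by (auto simp: ancestor_decomposition_def dest: spec[of _ 0])
    then show False using as by (simp add: ancestor_decomposition_def is_ancestor_def)
  qed
qed (simp add: ancestor_decomposition_def)

lemma ancestor_decomposition_Cons:
  "ancestor_decomposition G R w (a # as) \<longleftrightarrow>
     w = a \<otimes> word_prod G as \<and> is_ancestor G R w a \<and>
     ancestor_decomposition G R (word_prod G as) as"
  by (auto simp: ancestor_decomposition_def All_less_Suc2)

lemma ancestor_decomposition_closed:
  assumes "ancestor_decomposition G R w as"
  shows "set as \<subseteq> carrier G"
proof
  fix a assume "a \<in> set as"
  then obtain i where "i < length as" "a = as ! i" by (metis in_set_conv_nth)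
  then have "is_ancestor G R (word_prod G (drop i as)) a"
    using assms by (simp add: ancestor_decomposition_def)
  then show "a \<in> carrier G"
    by (auto simp: is_ancestor_def max_involution_prefixes_def involution_prefixes_def is_prefix_def)
qed

text \<open>Existence, uniqueness and length of the decomposition are proved together, by deleting the sources
  from the word. Since every involved ancestor is unique, the first term is determined, and
  cancelling it gives a decomposition of the product of the remaining word.\<close>

lemma ancestor_decomposition_longest_chain:
  assumes "distinct ys" "set ys \<subseteq> R"
  shows "\<exists>as. (\<forall>bs. ancestor_decomposition G R (word_prod G ys) bs \<longleftrightarrow> bs = as) \<and>
    (\<exists>p. letter_chain ys p \<and> length p = length as) \<and> (\<forall>p. letter_chain ys p \<longrightarrow> length p \<le> length as)"
  using assms
proof (induction ys rule: length_induct)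
  case (1 ys)
  note prems = 1(2,3)
  show ?case
  proof (cases "ys = []")
    case True
    then show ?thesis
      by (intro exI[of _ "[]"]) (auto simp: ancestor_decomposition_Nil letter_chain_def)
  next
    case False
    let ?zs = "filter (\<lambda>r. \<not> is_source ys r) ys"
    let ?a = "word_prod G (filter (is_source ys) ys)"
    have src: "is_source ys (hd ys)"
      using prems False is_source_hd by blast
    have "length ?zs < length ys"
      using src False by (intro length_filter_less[of "hd ys"]) auto
    then obtain as where as:
        "\<And>bs. ancestor_decomposition G R (word_prod G ?zs) bs \<longleftrightarrow> bs = as"
        "\<exists>p. letter_chain ?zs p \<and> length p = length as" "\<And>p. letter_chain ?zs p \<Longrightarrow> length p \<le> length as"
      using 1(1)[rule_format, of ?zs] prems by auto
    have anc: "is_ancestor G R (word_prod G ys) a \<longleftrightarrow> a = ?a" for a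
      using ancestor_iff[OF prems False] .
    have ne: "word_prod G ys \<noteq> \<one>" using anc[of ?a] by (simp add: is_ancestor_def)
    have split: "word_prod G ys = ?a \<otimes> word_prod G ?zs"
      using word_prod_sources prems by blast
    have cl: "?a \<in> carrier G" "word_prod G ?zs \<in> carrier G"
      using prems by (auto intro!: word_prod_closed)
    have asw: "word_prod G as = word_prod G ?zs"
      using as(1)[of as] by (simp add: ancestor_decomposition_def)
    have dec: "ancestor_decomposition G R (word_prod G ys) bs \<longleftrightarrow> bs = ?a # as" for bs
    proof (cases bs)
      case Nil
      then show ?thesis using ne by (simp add: ancestor_decomposition_def)
    next
      case (Cons b bs')
      show ?thesis
      proof
        assume bs: "ancestor_decomposition G R (word_prod G ys) bs"
        then have b: "b = ?a" and tl: "ancestor_decomposition G R (word_prod G bs') bs'"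
            and eq: "word_prod G ys = ?a \<otimes> word_prod G bs'"
          using anc by (auto simp: Cons ancestor_decomposition_Cons)
        have "word_prod G bs' \<in> carrier G"
          using ancestor_decomposition_closed[OF tl] by simp
        then have "word_prod G bs' = word_prod G ?zs"
          using eq split cl by simp
        then show "bs = ?a # as" using tl as(1) b Cons by simp
      next
        assume "bs = ?a # as"
        then show "ancestor_decomposition G R (word_prod G ys) bs"
          using anc split asw as(1) by (simp add: ancestor_decomposition_Cons)
      qed
    qed
    \<comment> \<open>Only the first vertex of a chain can be a source, so its tail survives the deletion.\<close>
    have upper: "length p \<le> Suc (length as)" if "letter_chain ys p" for p
    proof (cases p)
      case (Cons r q)
      then have "letter_chain ?zs q"
        using that letter_chain_tl_nonsource[of ys r q] by (auto simp: letter_chain_filter_nonsources letter_chain_Cons)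
      then show ?thesis using as(3) Cons by auto
    qed simp
    obtain q where q: "letter_chain ?zs q" "length q = length as" using as(2) by blast
    \<comment> \<open>A longest chain of the remaining word starts at a non-source of \<open>ys\<close> or is empty, so a letter
      can be put in front of it.\<close>
    have "\<exists>r. letter_chain ys (r # q)"
    proof (cases q)
      case Nil
      then show ?thesis using False by (auto simp: letter_chain_Cons intro: exI[of _ "hd ys"])
    next
      case (Cons s q')
      then have "\<not> is_source ys s" using q by (simp add: letter_chain_filter_nonsources)
      then obtain r where "appears_left_of ys r s" "coxeter_adj G R r s"
        by (auto simp: is_source_def)
      then have "letter_chain ys (r # q)"
        using q(1) unfolding letter_chain_filter_nonsources letter_chain_Cons Cons
        by (auto simp: appears_left_of_filter dest: appears_left_of_set)
      then show ?thesis ..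
    qed
    then show ?thesis using q dec upper
      by (intro exI[of _ "?a # as"]) (metis length_Cons)
  qed
qed

section \<open>Paths of a Coxeter element\<close>

text \<open>Which reduced word witnesses a \<open>w\<close>-path does not matter, since consecutive vertices do not commute
  and so have the same order in all reduced words.\<close>

lemma w_path_iff_chain:
  assumes "distinct ys" "set ys = R"
  shows "w_path G R (word_prod G ys) p \<longleftrightarrow> p \<noteq> [] \<and> letter_chain ys p"
proof
  assume "w_path G R (word_prod G ys) p"
  then obtain xs where p: "coxeter_path G R p" and xs: "reduced_expression G R (word_prod G ys) xs"
    and left: "\<And>i. Suc i < length p \<Longrightarrow> appears_left_of xs (p ! i) (p ! Suc i)"
    unfolding w_path_def by blast
  have "distinct xs" "set xs = R" "word_prod G xs = word_prod G ys"
    using reduced_expression_distinct[of ys xs] xs assms by auto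
  then have "appears_left_of ys r s" if "appears_left_of xs r s" "coxeter_adj G R r s" for r s
    using word_order_invariant[of xs ys r s] assms that by auto
  then show "p \<noteq> [] \<and> letter_chain ys p"
    using p left assms by (auto simp: coxeter_path_def letter_chain_def successively_conv_nth)
next
  assume p: "p \<noteq> [] \<and> letter_chain ys p"
  then have "coxeter_path G R p"
    using letter_chain_distinct[of ys p] assms
    by (auto simp: coxeter_path_def letter_chain_def successively_conv_nth)
  moreover have "reduced_expression G R (word_prod G ys) ys"
    using reduced_expression_distinct[of ys ys] assms by auto
  ultimately show "w_path G R (word_prod G ys) p"
    using p unfolding w_path_def letter_chain_def successively_conv_nth by blast
qed

lemma inv_length_eq_path_length:
  assumes "coxeter_element G R w" "R \<noteq> {}"
  shows "inv_length G R w = path_length G R w"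
proof -
  obtain ys where ys: "distinct ys" "set ys = R" "w = word_prod G ys"
    using assms(1) by (auto simp: coxeter_element_def)
  obtain as where as: "\<And>bs. ancestor_decomposition G R w bs \<longleftrightarrow> bs = as"
      "\<exists>p. letter_chain ys p \<and> length p = length as" "\<And>p. letter_chain ys p \<Longrightarrow> length p \<le> length as"
    using ancestor_decomposition_longest_chain[of ys] ys by auto
  have "inv_length G R w = length as" by (simp add: inv_length_def as(1))
  moreover have "path_length G R w = length as"
    unfolding path_length_def ys(3) w_path_iff_chain[OF ys(1,2)]
  proof (rule Max_eqI)
    show "finite {length p |p. p \<noteq> [] \<and> letter_chain ys p}"
    proof (rule finite_subset)
      show "{length p |p. p \<noteq> [] \<and> letter_chain ys p} \<subseteq> {..length as}" using as(3) by blast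
    qed simp
    obtain p where p: "letter_chain ys p" "length p = length as" using as(2) by blast
    obtain r where "r \<in> R" using assms(2) by blast
    then have "letter_chain ys [r]" using ys(2) by (simp add: letter_chain_Cons)
    then have "p \<noteq> []" using as(3)[of "[r]"] p by auto
    then show "length as \<in> {length p |p. p \<noteq> [] \<and> letter_chain ys p}"
      using p unfolding mem_Collect_eq by (intro exI[of _ p]) simp
    show "n \<le> length as" if "n \<in> {length p |p. p \<noteq> [] \<and> letter_chain ys p}" for n
      using that as(3) by blast
  qed
  ultimately show ?thesis by simp
qed

lemma finite_coxeter_elements:
  assumes "finite R"
  shows "finite {w. coxeter_element G R w}"
proof -
  have "{w. coxeter_element G R w} \<subseteq> word_prod G ` {xs. set xs \<subseteq> R \<and> distinct xs}"
    by (auto simp: coxeter_element_def)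
  then show ?thesis using finite_subset_distinct[OF assms] finite_surj by blast
qed

lemma finite_coxeter_path_lengths:
  assumes "finite R"
  shows "finite {length p |p. coxeter_path G R p}"
proof -
  have "{length p |p. coxeter_path G R p} \<subseteq> length ` {xs. set xs \<subseteq> R \<and> distinct xs}"
    by (auto simp: coxeter_path_def)
  then show ?thesis using finite_subset_distinct[OF assms] finite_surj by blast
qed

text \<open>The Coxeter element is the product of the word that lists \<open>p\<close> first and then the remaining
  letters in any order.\<close>

lemma coxeter_path_is_w_path:
  assumes "coxeter_path G R p" "finite R"
  obtains w where "coxeter_element G R w" "w_path G R w p"
proof -
  obtain zs where zs: "distinct zs" "set zs = R - set p"
    using finite_distinct_list[of "R - set p"] assms(2) by auto
  let ?ys = "p @ zs"
  have p: "p \<noteq> []" "distinct p" "set p \<subseteq> R" "successively (coxeter_adj G R) p"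
    using assms(1) by (auto simp: coxeter_path_def)
  have ys: "distinct ?ys" "set ?ys = R" using zs p by auto
  have "appears_left_of p (p ! i) (p ! Suc i)" if "Suc i < length p" for i
    unfolding appears_left_of_def using that by (intro exI[of _ i] exI[of _ "Suc i"]) simp
  then have "letter_chain ?ys p"
    using p by (auto simp: letter_chain_def successively_conv_nth)
  then have "w_path G R (word_prod G ?ys) p"
    using w_path_iff_chain[OF ys] p by simp
  moreover have "coxeter_element G R (word_prod G ?ys)"
    using ys unfolding coxeter_element_def by blast
  ultimately show ?thesis using that by blast
qed

lemma Max_path_length:
  assumes "finite R" "R \<noteq> {}"
  shows "Max (path_length G R ` {w. coxeter_element G R w}) = max_path_length G R"
proof (rule antisym)
  let ?P = "{length p |p. coxeter_path G R p}"
  let ?W = "\<lambda>w. {length p |p. w_path G R w p}"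
  have fin: "finite ?P" and sub: "?W w \<subseteq> ?P" for w
    using finite_coxeter_path_lengths[OF assms(1)] by (auto simp: w_path_def)
  obtain r where "r \<in> R" using assms(2) by blast
  then have path1: "coxeter_path G R [r]" by (simp add: coxeter_path_def)
  have nonempty: "?W w \<noteq> {}" if w: "coxeter_element G R w" for w
  proof -
    obtain ys where "distinct ys" "set ys = R" "w = word_prod G ys"
      using w by (auto simp: coxeter_element_def)
    then have "w_path G R w [r]"
      using w_path_iff_chain[of ys "[r]"] \<open>r \<in> R\<close> by (simp add: letter_chain_Cons)
    then show ?thesis by blast
  qed
  obtain w1 where w1: "coxeter_element G R w1"
    using coxeter_path_is_w_path[OF path1 assms(1)] by blast
  have finW: "finite (path_length G R ` {w. coxeter_element G R w})"
    using finite_coxeter_elements[OF assms(1)] by simp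
  have "path_length G R w \<le> max_path_length G R" if "coxeter_element G R w" for w
    unfolding path_length_def max_path_length_def by (rule Max_mono[OF sub nonempty[OF that] fin])
  then show "Max (path_length G R ` {w. coxeter_element G R w}) \<le> max_path_length G R"
    using finW w1 by (subst Max_le_iff) auto
  have "max_path_length G R \<in> ?P"
    unfolding max_path_length_def using fin path1 by (intro Max_in) auto
  then obtain p where p: "coxeter_path G R p" "length p = max_path_length G R" by auto
  obtain w where w: "coxeter_element G R w" "w_path G R w p"
    using coxeter_path_is_w_path[OF p(1) assms(1)] by blast
  have "length p \<le> path_length G R w"
    unfolding path_length_def using w finite_subset[OF sub fin] by (intro Max_ge) auto
  also have "\<dots> \<le> Max (path_length G R ` {w. coxeter_element G R w})"
    using finW w by (intro Max_ge) auto
  finally show "max_path_length G R \<le> Max (path_length G R ` {w. coxeter_element G R w})"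
    using p by simp
qed

end

theorem proposition2p5:
  fixes G :: "('a, 'b) monoid_scheme" and R :: "'a set"
  assumes "coxeter_system G R" and "finite R" and "R \<noteq> {}"
  shows "(\<forall>w. coxeter_element G R w \<longrightarrow> inv_length G R w = path_length G R w) \<and>
    Max (inv_length G R ` {w. coxeter_element G R w}) = max_path_length G R"
proof -
  interpret coxeter_system G R by fact
  have eq: "inv_length G R w = path_length G R w" if "coxeter_element G R w" for w
    using inv_length_eq_path_length[OF that assms(3)] .
  then have "inv_length G R ` {w. coxeter_element G R w} = path_length G R ` {w. coxeter_element G R w}"
    by (intro image_cong) auto
  then show ?thesis using eq Max_path_length[OF assms(2,3)] by simp
qed

end
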